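(* Let $p=5$. For each $z\in\{0,1,2,3\}$, every multiset $Q$ of length $13-z$ over $\mathbb{F}_5^2\setminus\{(0,0)\}$ such that $m_L(Q)\le 8-z$ for all lines $L$ satisfies $\sigma(Q)\ge 4-z$.
   Context: Lengths of multisets count multiplicity. A line is a $1$-dimensional $\mathbb{F}_5$-linear subspace $L$ of $\mathbb{F}_5^2$, and $m_L(Q)$ is the number of elements of $Q$, counted with multiplicity, lying on $L$. For a finite multiset $B=\{q_1,\dots,q_k\}$ over $\mathbb{F}_5^2$ with $q_i=(a_i,b_i)$, the cross-sum set is $$\Omega(B)=\Big\{\sum_{1\le s<t\le k}a_{\tau(s)}b_{\tau(t)}\;:\;\tau\in S_k\Big\}\subseteq\mathbb{F}_5,$$ where $\tau$ ranges over all permutations of $\{1,\dots,k\}$. A multiset over $\mathbb{F}_5^2$ is zero-sum if the sum of its elements is $(0,0)$. The spread of a multiset $Q$ over $\mathbb{F}_5^2\setminus\{(0,0)\}$ is $$\sigma(Q)=\max\sum_{j=1}^{t}\big(|\Omega(B_j)|-1\big),$$ the maximum being over all families of pairwise-disjoint nonempty zero-sum sub-multisets $B_1,\dots,B_t$ of $Q$ (disjoint meaning that the multiplicities used in total do not exceed those of $Q$; the empty family contributes $0$). *)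

theory Defs
  imports
    "HOL-Analysis.Analysis"
    "HOL-Combinatorics.Combinatorics"
    "Berlekamp_Zassenhaus.Finite_Field"
begin

text \<open>The five-element index type makes \<open>five mod_ring\<close> the field of integers modulo 5;
  the numeral type \<open>5\<close> is only a commutative ring in the library.\<close>

typedef five = "{0..<5::nat}"
  by (rule exI[of _ 0]) simp

lemma CARD_five [simp]: "CARD(five) = 5"
  using type_definition.card[OF type_definition_five] by simp

instance five :: prime_card
  by standard simp

type_synonym F5 = "five mod_ring"

text \<open>Points are vectors with coordinates \<open>q $ 1\<close> and \<open>q $ 2\<close>. Indices into lists start at 0.\<close>

definition cross_sum :: "(F5 ^ 2) list \<Rightarrow> F5" where
  "cross_sum qs = (\<Sum>t<length qs. \<Sum>s<t. (qs ! s) $ 1 * (qs ! t) $ 2)"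

text \<open>Permuting an enumeration of a multiset \<open>B\<close> in all possible ways yields exactly the lists
  with underlying multiset \<open>B\<close>; see \<open>cross_sum_set_mset\<close> below.\<close>

definition cross_sum_set :: "(F5 ^ 2) multiset \<Rightarrow> F5 set" where
  "cross_sum_set B = cross_sum ` permutations_of_multiset B"

lemma cross_sum_set_mset:
  "cross_sum_set (mset qs) =
    {(\<Sum>t<length qs. \<Sum>s<t. (qs ! \<tau> s) $ 1 * (qs ! \<tau> t) $ 2) | \<tau>. \<tau> permutes {..<length qs}}"
proof -
  have perm: "permutations_of_multiset (mset qs) =
      (\<lambda>\<tau>. permute_list \<tau> qs) ` {\<tau>. \<tau> permutes {..<length qs}}"
    by (auto simp: permutations_of_multiset_def elim: mset_eq_permutation)
  have eq: "cross_sum (permute_list \<tau> qs) =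
      (\<Sum>t<length qs. \<Sum>s<t. (qs ! \<tau> s) $ 1 * (qs ! \<tau> t) $ 2)"
    if "\<tau> permutes {..<length qs}" for \<tau>
    unfolding cross_sum_def using that
    by (auto simp: permute_list_nth intro!: sum.cong)
  show ?thesis
    unfolding cross_sum_set_def perm image_image by (auto simp: eq image_def)
qed

definition line :: "(F5 ^ 2) set \<Rightarrow> bool" where
  "line L \<longleftrightarrow> vec.subspace L \<and> vec.dim L = 1"

definition line_mult :: "(F5 ^ 2) set \<Rightarrow> (F5 ^ 2) multiset \<Rightarrow> nat" where
  "line_mult L Q = size {# q \<in># Q. q \<in> L #}"

definition zero_sum :: "(F5 ^ 2) multiset \<Rightarrow> bool" where
  "zero_sum B \<longleftrightarrow> sum_mset B = 0"

text \<open>A family of blocks is a multiset of multisets, so that equal blocks may be repeated;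
  the blocks are disjoint in \<open>Q\<close> if their multiset sum is contained in \<open>Q\<close>.\<close>

definition zero_sum_families :: "(F5 ^ 2) multiset \<Rightarrow> (F5 ^ 2) multiset multiset set" where
  "zero_sum_families Q = {F. (\<forall>B \<in># F. B \<noteq> {#} \<and> zero_sum B) \<and> sum_mset F \<subseteq># Q}"

definition spread :: "(F5 ^ 2) multiset \<Rightarrow> nat" where
  "spread Q = Max ((\<lambda>F. \<Sum>B\<in>#F. card (cross_sum_set B) - 1) ` zero_sum_families Q)"

text \<open>The maximum is over a finite nonempty set, and the subtraction is never truncated.\<close>

lemma empty_in_zero_sum_families: "{#} \<in> zero_sum_families Q"
  by (simp add: zero_sum_families_def)

lemma finite_zero_sum_families: "finite (zero_sum_families Q)"
proof (rule finite_subset)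
  show "zero_sum_families Q \<subseteq> (\<Union>n\<le>size Q. multisets_of_size {B. B \<subseteq># Q} n)"
  proof
    fix F assume F: "F \<in> zero_sum_families Q"
    then have sub: "sum_mset F \<subseteq># Q" and ne: "\<And>B. B \<in># F \<Longrightarrow> B \<noteq> {#}"
      by (auto simp: zero_sum_families_def)
    have "size F \<le> size (sum_mset F)"
      using ne
    proof (induction F)
      case (add B F)
      then have "size B \<ge> 1" by (simp add: Suc_le_eq nonempty_has_size)
      with add show ?case by fastforce
    qed simp
    also have "\<dots> \<le> size Q" using sub by (rule size_mset_mono)
    finally have "size F \<le> size Q" .
    moreover have "B \<subseteq># Q" if B: "B \<in># F" for B
    proof -
      obtain G where "F = add_mset B G" using B by (meson mset_add)
      then have "B \<subseteq># sum_mset F" by simp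
      with sub show ?thesis by (rule subset_mset.order_trans[rotated])
    qed
    ultimately show "F \<in> (\<Union>n\<le>size Q. multisets_of_size {B. B \<subseteq># Q} n)"
      by (auto simp: multisets_of_size_def)
  qed
  have "{B. B \<subseteq># Q} \<subseteq> (\<Union>n\<le>size Q. multisets_of_size (set_mset Q) n)"
    by (auto simp: multisets_of_size_def dest: size_mset_mono mset_subset_eqD)
  then have "finite {B. B \<subseteq># Q}"
    by (rule finite_subset) (auto intro!: finite_multisets_of_size)
  then show "finite (\<Union>n\<le>size Q. multisets_of_size {B. B \<subseteq># Q} n)"
    by (auto intro!: finite_multisets_of_size)
qed

lemma card_cross_sum_set_pos: "card (cross_sum_set B) \<ge> 1"
  by (simp add: cross_sum_set_def Suc_le_eq card_gt_0_iff)

end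

theory Submission
  imports Defs
begin

text \<open>
  Put \<open>k = 4 - z\<close>, so that \<open>Q\<close> has \<open>9 + k\<close> elements and at least five of them lie off each line.
  A single zero-sum block already has the required spread: it suffices to find a zero-sum
  \<open>B\<close> in \<open>Q\<close> that spans the plane and has at least \<open>k + 2\<close> elements. Two facts are behind this.

  Growth. Putting a new element \<open>x\<close> after, respectively before, an ordering of \<open>X\<close> shifts its cross sum
  by two amounts that differ by \<open>det(\<Sigma>X, x)\<close>. So the cross-sum set gains an element
  (until it is the whole field) whenever \<open>x\<close> is not parallel to the sum of \<open>X\<close>. A zero-sum multiset
  of nonzero vectors that spans the plane can be built up so that every step except the first
  and the last is of this kind, hence its cross-sum set has at least \<open>min 5 (|B| - 1)\<close> elements
  (\<open>card_cross_sum_set_zero_sum\<close>).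

  Olson's theorem. Let \<open>N(g)\<close> count the sub-multisets of \<open>R\<close> with sum \<open>g\<close>, with sign \<open>(-1)\<close> to the
  size, as an element of the field. Each element of \<open>R\<close> acts on \<open>N\<close> by a difference operator, and the
  starting point, the indicator function of the origin, is a polynomial of degree 8. So \<open>N\<close> is
  constant for \<open>|R| = 8\<close> and zero for \<open>|R| = 9\<close>. The latter gives that zero-sum-free multisets have
  at most eight elements. The former gives that in a zero-sum-free \<open>R\<close> of size eight, a nonzero
  vector that is a subsum only in the trivial way, as a single element, has multiplicity at
  least four (\<open>zero_sum_free_count_ge_4\<close>): its signed count is minus its multiplicity, and equals
  \<open>N(0) = 1\<close>.

  Now take a largest zero-sum \<open>B\<close> in \<open>Q\<close> that spans the plane (\<open>ex_noncollinear_zero_sum\<close> provides one) and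
  suppose \<open>|B| \<le> k + 1\<close>. By maximality \<open>R = Q - B\<close> is zero-sum-free, so \<open>|R| = 8\<close>. Again by maximality, an
  element \<open>b\<close> of \<open>B\<close> cannot be exchanged for two or more elements of \<open>R\<close> with sum \<open>b\<close>, so it has
  multiplicity at least four in \<open>R\<close>. But in \<open>B\<close>, which has at most five elements and is not
  constant, every multiplicity is at most four. Therefore \<open>B\<close> is contained in \<open>R\<close>, which
  contradicts that \<open>R\<close> is zero-sum-free.
\<close>


section \<open>Arithmetic in the field of five elements\<close>

lemma of_nat_F5_eq_0_iff: "(of_nat n :: F5) = 0 \<longleftrightarrow> 5 dvd n"
  by (simp add: of_nat_eq_0_iff_char_dvd)

lemma F5_power4:
  assumes "(x::F5) \<noteq> 0"
  shows "x ^ 4 = 1"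
proof -
  obtain i where i: "i < CARD(five)" and x: "x = of_nat i"
    using surj_of_nat_mod_ring by blast
  have "i < 5" using i by simp
  moreover have "i \<noteq> 0" using x assms by (metis of_nat_0)
  ultimately have "i \<in> {1, 2, 3, 4}" by (simp, linarith)
  then have "i ^ 4 mod 5 = 1" by auto
  then have "(of_nat (i ^ 4) :: F5) = of_nat 1"
    by (metis CARD_five of_nat_mod_CHAR semiring_char_mod_ring)
  then show ?thesis using x by simp
qed

text \<open>A set that is mapped into itself by a nonzero translation is the whole prime field. This is
  the case of the Cauchy-Davenport inequality in which one summand has two elements.\<close>

lemma card_Un_translate_ge:
  fixes P :: "F5 set"
  assumes "P \<noteq> {}" and "d \<noteq> 0"
  shows "card (P \<union> (+) d ` P) \<ge> min 5 (card P + 1)"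
proof (cases "(+) d ` P \<subseteq> P")
  case True
  obtain x where x: "x \<in> P" using assms by blast
  have step: "x + of_nat n * d \<in> P" for n
  proof (induction n)
    case (Suc n)
    then have "d + (x + of_nat n * d) \<in> P" using True by blast
    then show ?case by (simp add: algebra_simps)
  qed (simp add: x)
  have "y \<in> P" for y
  proof -
    obtain n where "(y - x) / d = of_nat n" using surj_of_nat_mod_ring by blast
    then have "y = x + of_nat n * d" using assms(2) by (simp add: field_simps)
    then show ?thesis using step by simp
  qed
  then have "P = UNIV" by blast
  then show ?thesis by simp
next
  case False
  then have "P \<subset> P \<union> (+) d ` P" by blast
  then have "card P < card (P \<union> (+) d ` P)" by (intro psubset_card_mono) auto
  then show ?thesis by simp
qed

text \<open>Each further nonzero term adds a new subset sum, so four terms reach all five residues.\<close>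

lemma subset_sums_cover_F5:
  fixes f :: "'a \<Rightarrow> F5"
  assumes "\<And>x. x \<in># X \<Longrightarrow> f x \<noteq> 0" and "size X \<ge> 4"
  shows "\<exists>T. T \<subseteq># X \<and> (\<Sum>x\<in>#T. f x) = g"
proof -
  define S where "S X = (\<lambda>T. \<Sum>x\<in>#T. f x) ` {T. T \<subseteq># X}" for X
  have ne: "S X \<noteq> {}" for X unfolding S_def by auto
  have "card (S X) \<ge> min 5 (size X + 1)"
    using assms(1)
  proof (induction X)
    case empty
    then show ?case by (simp add: S_def)
  next
    case (add x X)
    have "S X \<union> (+) (f x) ` S X \<subseteq> S (add_mset x X)"
    proof
      fix v assume "v \<in> S X \<union> (+) (f x) ` S X"
      then consider T where "T \<subseteq># X" "v = (\<Sum>x\<in>#T. f x)"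
        | T where "T \<subseteq># X" "v = f x + (\<Sum>x\<in>#T. f x)"
        unfolding S_def by blast
      then show "v \<in> S (add_mset x X)"
      proof cases
        case 1
        then have "T \<subseteq># add_mset x X" by (simp add: subset_mset.order_trans[of _ X])
        with 1 show ?thesis unfolding S_def by blast
      next
        case 2
        then have "add_mset x T \<subseteq># add_mset x X" "v = (\<Sum>x\<in>#add_mset x T. f x)" by auto
        then show ?thesis unfolding S_def by blast
      qed
    qed
    then have "card (S X \<union> (+) (f x) ` S X) \<le> card (S (add_mset x X))"
      by (rule card_mono[rotated]) simp
    moreover have "card (S X \<union> (+) (f x) ` S X) \<ge> min 5 (card (S X) + 1)"
      using add.prems by (intro card_Un_translate_ge ne) auto
    moreover have "card (S X) \<ge> min 5 (size X + 1)" using add by auto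
    ultimately show ?case by simp
  qed
  then have "card (S X) \<ge> 5" using assms(2) by simp
  then have "card (S X) = card (UNIV :: F5 set)"
    using card_mono[of "UNIV :: F5 set" "S X"] by simp
  then have "S X = UNIV" by (intro card_subset_eq) auto
  then have "g \<in> S X" by simp
  then show ?thesis unfolding S_def by blast
qed


section \<open>Lines and the determinant\<close>

text \<open>Vanishing of this determinant is used as the parallelism relation; it treats the zero vector as
  parallel to everything, so transitivity needs a nonzero middle vector.\<close>

definition det2 :: "F5 ^ 2 \<Rightarrow> F5 ^ 2 \<Rightarrow> F5" where
  "det2 q r = q $ 1 * r $ 2 - q $ 2 * r $ 1"

lemma det2_add_left: "det2 (q + q') r = det2 q r + det2 q' r"
  and det2_add_right: "det2 q (r + r') = det2 q r + det2 q r'"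
  and det2_self [simp]: "det2 q q = 0"
  and det2_zero [simp]: "det2 0 q = 0" "det2 q 0 = 0"
  and det2_swap: "det2 r q = - det2 q r"
  by (simp_all add: det2_def algebra_simps)

lemma det2_eq_0_swap: "det2 r q = 0 \<longleftrightarrow> det2 q r = 0"
  by (simp add: det2_swap[of r q])

lemma det2_sum_mset_right: "det2 q (sum_mset M) = (\<Sum>m\<in>#M. det2 q m)"
  by (induction M) (simp_all add: det2_add_right)

lemma det2_sum_mset_eq_0:
  assumes "\<And>m. m \<in># M \<Longrightarrow> det2 q m = 0"
  shows "det2 q (sum_mset M) = 0"
  using assms by (induction M) (simp_all add: det2_add_right)

lemma det2_eq_0_imp_scaled:
  assumes "a \<noteq> 0" and "det2 a q = 0"
  shows "\<exists>t. q = t *s a"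
proof (cases "a $ 1 = 0")
  case True
  then have "a $ 2 \<noteq> 0" using assms(1) by (auto simp: vec_eq_iff forall_2)
  moreover from this have "q $ 1 = 0" using True assms(2) by (simp add: det2_def)
  ultimately have "q = (q $ 2 / a $ 2) *s a"
    using True by (simp add: vec_eq_iff forall_2)
  then show ?thesis by blast
next
  case False
  then have "q = (q $ 1 / a $ 1) *s a"
    using assms(2) by (simp add: vec_eq_iff forall_2 det2_def field_simps)
  then show ?thesis by blast
qed

lemma det2_scaled [simp]: "det2 (t *s q) r = t * det2 q r" "det2 q (t *s r) = t * det2 q r"
  by (simp_all add: det2_def algebra_simps)

lemma det2_eq_0_trans:
  assumes "a \<noteq> 0" and "det2 a q = 0" and "det2 a r = 0"
  shows "det2 q r = 0"
  using det2_eq_0_imp_scaled[OF assms(1,2)] det2_eq_0_imp_scaled[OF assms(1,3)] by auto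

lemma line_det2:
  assumes "a \<noteq> 0"
  shows "line {q. det2 a q = 0}"
proof -
  have eq: "{q. det2 a q = 0} = vec.span {a}"
    using det2_eq_0_imp_scaled[OF assms] by (auto simp: vec.span_singleton)
  show ?thesis unfolding line_def eq using assms by simp
qed

definition collinear_mset :: "(F5 ^ 2) multiset \<Rightarrow> bool" where
  "collinear_mset B \<longleftrightarrow> (\<forall>q\<in>#B. \<forall>r\<in>#B. det2 q r = 0)"


section \<open>Growth of the cross-sum set\<close>

lemma cross_sum_Nil [simp]: "cross_sum [] = 0"
  by (simp add: cross_sum_def)

lemma cross_sum_snoc: "cross_sum (xs @ [x]) = cross_sum xs + sum_list xs $ 1 * x $ 2"
proof -
  have "sum_list xs $ 1 = (\<Sum>s<length xs. (xs ! s) $ 1)"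
    by (simp add: sum_list_sum_nth atLeast0LessThan)
  then show ?thesis
    by (simp add: cross_sum_def nth_append sum_distrib_right)
qed

lemma cross_sum_Cons: "cross_sum (x # xs) = cross_sum xs + x $ 1 * sum_list xs $ 2"
proof (induction xs rule: rev_induct)
  case Nil
  show ?case using cross_sum_snoc[of "[]" x] by simp
next
  case (snoc y xs)
  have "cross_sum (x # xs @ [y]) = cross_sum (x # xs) + sum_list (x # xs) $ 1 * y $ 2"
    using cross_sum_snoc[of "x # xs" y] by simp
  then show ?case using snoc by (simp add: cross_sum_snoc algebra_simps)
qed

text \<open>The two inclusions come from putting \<open>x\<close> last and putting \<open>x\<close> first.\<close>

lemma cross_sum_set_add_mset:
  "(+) (sum_mset X $ 1 * x $ 2) ` cross_sum_set X \<subseteq> cross_sum_set (add_mset x X)"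
  "(+) (x $ 1 * sum_mset X $ 2) ` cross_sum_set X \<subseteq> cross_sum_set (add_mset x X)"
proof -
  have "sum_mset X $ 1 * x $ 2 + cross_sum xs \<in> cross_sum_set (add_mset x X)"
    and "x $ 1 * sum_mset X $ 2 + cross_sum xs \<in> cross_sum_set (add_mset x X)"
    if "mset xs = X" for xs
  proof -
    have s: "sum_mset X = sum_list xs" using that by (simp add: sum_mset_sum_list[symmetric])
    have "xs @ [x] \<in> permutations_of_multiset (add_mset x X)"
      "x # xs \<in> permutations_of_multiset (add_mset x X)"
      using that by (auto simp: permutations_of_multiset_def)
    moreover have "cross_sum (xs @ [x]) = sum_mset X $ 1 * x $ 2 + cross_sum xs"
      "cross_sum (x # xs) = x $ 1 * sum_mset X $ 2 + cross_sum xs"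
      by (simp_all add: cross_sum_snoc cross_sum_Cons s)
    ultimately show "sum_mset X $ 1 * x $ 2 + cross_sum xs \<in> cross_sum_set (add_mset x X)"
      "x $ 1 * sum_mset X $ 2 + cross_sum xs \<in> cross_sum_set (add_mset x X)"
      unfolding cross_sum_set_def by (metis imageI)+
  qed
  then show "(+) (sum_mset X $ 1 * x $ 2) ` cross_sum_set X \<subseteq> cross_sum_set (add_mset x X)"
    "(+) (x $ 1 * sum_mset X $ 2) ` cross_sum_set X \<subseteq> cross_sum_set (add_mset x X)"
    unfolding cross_sum_set_def[of X] permutations_of_multiset_def by auto
qed

lemma card_cross_sum_set_mono: "card (cross_sum_set X) \<le> card (cross_sum_set (add_mset x X))"
proof -
  have "card (cross_sum_set X) = card ((+) (sum_mset X $ 1 * x $ 2) ` cross_sum_set X)"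
    by (simp add: card_image)
  also have "\<dots> \<le> card (cross_sum_set (add_mset x X))"
    by (intro card_mono cross_sum_set_add_mset) simp
  finally show ?thesis .
qed

text \<open>The two translates of \<open>cross_sum_set X\<close> inside the larger set differ by the determinant.\<close>

lemma card_cross_sum_set_grow:
  assumes "det2 (sum_mset X) x \<noteq> 0"
  shows "card (cross_sum_set (add_mset x X)) \<ge> min 5 (card (cross_sum_set X) + 1)"
proof -
  define P where "P = (+) (x $ 1 * sum_mset X $ 2) ` cross_sum_set X"
  have cardP: "card P = card (cross_sum_set X)" by (simp add: P_def card_image)
  then have ne: "P \<noteq> {}" using card_cross_sum_set_pos[of X] by auto
  have "(+) (det2 (sum_mset X) x) ` P = (+) (sum_mset X $ 1 * x $ 2) ` cross_sum_set X"
    unfolding P_def image_image by (intro image_cong) (auto simp: det2_def algebra_simps)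
  then have "P \<union> (+) (det2 (sum_mset X) x) ` P \<subseteq> cross_sum_set (add_mset x X)"
    using cross_sum_set_add_mset[where X = X and x = x] unfolding P_def by auto
  then have "card (P \<union> (+) (det2 (sum_mset X) x) ` P) \<le> card (cross_sum_set (add_mset x X))"
    by (intro card_mono) simp_all
  then show ?thesis using card_Un_translate_ge[OF ne assms] cardP by simp
qed

text \<open>Add elements one at a time, never one parallel to the current sum, for as long as possible.
  The process ends with a multiset \<open>X + x\<close>, whose leftover elements are all parallel to its sum \<open>s\<close>.
  The sum of \<open>X\<close> is not parallel to \<open>s\<close>, and adding multiples of \<open>s\<close> to it does not change that. So
  all leftover elements can be added to \<open>X\<close> with growth, which leaves \<open>x\<close> as the only element that
  need not contribute.\<close>

lemma card_cross_sum_set_zero_sum: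
  assumes zs: "zero_sum B" and nz: "0 \<notin># B" and nc: "\<not> collinear_mset B"
  shows "card (cross_sum_set B) \<ge> min 5 (size B - 1)"
proof -
  define good where "good X \<longleftrightarrow> card (cross_sum_set X) \<ge> min 5 (size X)" for X
  have good_add: "good (add_mset x X)" if "good X" "det2 (sum_mset X) x \<noteq> 0" for x X
    using card_cross_sum_set_grow[OF that(2)] that(1) unfolding good_def by simp
  \<comment> \<open>\<open>chain n\<close>: the process can make a growing step from a multiset of size \<open>n\<close>.\<close>
  define chain where "chain n \<longleftrightarrow> (\<exists>X x. size X = n \<and> good X \<and>
    det2 (sum_mset X) x \<noteq> 0 \<and> add_mset x X \<subseteq># B)" for n
  obtain q r where qr: "q \<in># B" "r \<in># B" "det2 q r \<noteq> 0"
    using nc unfolding collinear_mset_def by blast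
  then have "q \<noteq> r" by auto
  then have "{#r, q#} \<subseteq># B" using qr by (simp add: insert_subset_eq_iff in_diff_count)
  moreover have "good {#q#}" using card_cross_sum_set_pos[of "{#q#}"] by (simp add: good_def)
  ultimately have "chain 1" unfolding chain_def using qr(3)
    by (intro exI[of _ "{#q#}"] exI[of _ r]) simp
  moreover have bound: "n \<le> size B" if "chain n" for n
    using that size_mset_mono unfolding chain_def by fastforce
  ultimately obtain n where n: "chain n" "\<And>n'. chain n' \<Longrightarrow> n' \<le> n"
    using Nat.ex_has_greatest_nat[of chain 1 "size B"] by blast
  from n(1) obtain X x where X: "size X = n" "good X" "det2 (sum_mset X) x \<noteq> 0"
    "add_mset x X \<subseteq># B" unfolding chain_def by blast
  define s where "s = sum_mset (add_mset x X)"
  define M where "M = B - add_mset x X"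
  have B: "B = add_mset x (X + M)" using X(4) unfolding M_def
    by (metis subset_mset.add_diff_inverse union_mset_add_mset_left)
  have s_det: "det2 (sum_mset X) s = det2 (sum_mset X) x"
    by (simp add: s_def det2_add_right)
  then have s0: "s \<noteq> 0" using X(3) by auto
  have M_par: "det2 s m = 0" if "m \<in># M" for m
  proof (rule ccontr)
    assume "det2 s m \<noteq> 0"
    moreover obtain M' where "M = add_mset m M'" using \<open>m \<in># M\<close> by (metis mset_add)
    then have "B = add_mset m (add_mset x X) + M'" using B by simp
    then have "add_mset m (add_mset x X) \<subseteq># B" by (metis mset_subset_eq_add_left)
    ultimately have "chain (Suc n)"
      using X good_add[OF X(2,3)] unfolding chain_def s_def
      by (intro exI[of _ "add_mset x X"] exI[of _ m]) simp
    then show False using n(2) by fastforce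
  qed
  \<comment> \<open>From here on \<open>x\<close> is held back and the elements of \<open>M\<close> are added to \<open>X\<close> directly.\<close>
  have "good (X + N)" if "N \<subseteq># M" for N
    using that
  proof (induction N)
    case (add m N)
    have N: "N \<subseteq># M" using add.prems(1) by (metis mset_subset_eq_insertD subset_mset.less_imp_le)
    have m: "m \<in># M" using add.prems by (auto dest: mset_subset_eqD)
    then have "m \<noteq> 0" using B nz by auto
    have "det2 s (sum_mset N) = 0"
      using M_par N by (intro det2_sum_mset_eq_0) (auto dest: mset_subset_eqD)
    then have "det2 (sum_mset N) m = 0" using M_par[OF m] s0 by (blast intro: det2_eq_0_trans)
    moreover obtain t where "m = t *s s" using det2_eq_0_imp_scaled[OF s0 M_par[OF m]] by blast
    then have "det2 (sum_mset X) m \<noteq> 0" using \<open>m \<noteq> 0\<close> X(3) s_det by auto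
    ultimately have "det2 (sum_mset (X + N)) m \<noteq> 0" by (simp add: det2_add_left)
    then show ?case using add.IH N add.prems good_add by auto
  qed (simp add: X)
  from this[of M] have "min 5 (size (X + M)) \<le> card (cross_sum_set (X + M))"
    by (simp add: good_def)
  also have "\<dots> \<le> card (cross_sum_set B)" unfolding B by (rule card_cross_sum_set_mono)
  finally show ?thesis by (simp add: B)
qed


section \<open>Functions of bounded difference degree\<close>

text \<open>Polynomial functions of degree at most \<open>n\<close> have this property. Defining the degree by
  differences makes the effect of adding an element to a multiset immediate, and reduces the needed facts on polynomials to a product rule.\<close>

primrec diff_degree_le :: "nat \<Rightarrow> ('a::ab_group_add \<Rightarrow> 'b::comm_ring_1) \<Rightarrow> bool" where
  "diff_degree_le 0 f \<longleftrightarrow> (\<exists>c. \<forall>x. f x = c)"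
| "diff_degree_le (Suc n) f \<longleftrightarrow> (\<forall>y. diff_degree_le n (\<lambda>x. f x - f (x - y)))"

lemma diff_degree_le_const: "diff_degree_le n (\<lambda>_. c)"
  by (induction n arbitrary: c) auto

lemma diff_degree_le_diff:
  "diff_degree_le n f \<Longrightarrow> diff_degree_le n g \<Longrightarrow> diff_degree_le n (\<lambda>x. f x - g x)"
proof (induction n arbitrary: f g)
  case 0
  then show ?case by auto
next
  case (Suc n)
  have "diff_degree_le n (\<lambda>x. (f x - f (x - y)) - (g x - g (x - y)))" for y
    using Suc by simp
  then show ?case by (simp add: algebra_simps)
qed

lemma diff_degree_le_add:
  assumes "diff_degree_le n f" and "diff_degree_le n g"
  shows "diff_degree_le n (\<lambda>x. f x + g x)"
  using diff_degree_le_diff[OF assms(1) diff_degree_le_diff[OF diff_degree_le_const assms(2)], of 0]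
  by simp

lemma diff_degree_le_Suc: "diff_degree_le n f \<Longrightarrow> diff_degree_le (Suc n) f"
proof (induction n arbitrary: f)
  case 0
  then show ?case by auto
next
  case (Suc n)
  then show ?case by (metis diff_degree_le.simps(2))
qed

lemma diff_degree_le_scale: "diff_degree_le n f \<Longrightarrow> diff_degree_le n (\<lambda>x. c * f x)"
proof (induction n arbitrary: f)
  case 0
  then show ?case by auto
next
  case (Suc n)
  then have "diff_degree_le n (\<lambda>x. c * (f x - f (x - y)))" for y by simp
  then show ?case by (simp add: algebra_simps)
qed

text \<open>The Leibniz rule \<open>\<Delta>(f g) = (\<Delta> f) g + f' (\<Delta> g)\<close>, where \<open>f'\<close> is \<open>f\<close> translated, and induction on
  the total degree.\<close>

lemma diff_degree_le_mult:
  "diff_degree_le a f \<Longrightarrow> diff_degree_le b g \<Longrightarrow> diff_degree_le (a + b) (\<lambda>x. f x * g x)"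
proof (induction "a + b" arbitrary: a b f g rule: less_induct)
  case less
  show ?case
  proof (cases a)
    case 0
    then obtain c where f: "f x = c" for x
      using less.prems(1) by auto
    show ?thesis using diff_degree_le_scale[OF less.prems(2), of c] by (simp add: f 0)
  next
    case (Suc a')
    show ?thesis
    proof (cases b)
      case 0
      then obtain c where g: "g x = c" for x
        using less.prems(2) by auto
      show ?thesis using diff_degree_le_scale[OF less.prems(1), of c]
        by (simp add: g 0 mult.commute)
    next
      case (Suc b')
      have f: "diff_degree_le a' (\<lambda>x. f x - f (x - y))" for y
        using less.prems(1) \<open>a = Suc a'\<close> by simp
      have g: "diff_degree_le b' (\<lambda>x. g x - g (x - y))" for y
        using less.prems(2) Suc by simp
      \<comment> \<open>\<open>f'\<close> is \<open>f\<close> minus its difference, so translation preserves the degree bound.\<close>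
      have f_shift: "diff_degree_le a (\<lambda>x. f (x - y))" for y
        using diff_degree_le_diff[OF less.prems(1) diff_degree_le_Suc[OF f[of y], folded \<open>a = Suc a'\<close>]]
        by simp
      have "diff_degree_le (a' + b) (\<lambda>x. (f x - f (x - y)) * g x)" for y
        using less.hyps[OF _ f less.prems(2)] \<open>a = Suc a'\<close> by simp
      moreover have "diff_degree_le (a + b') (\<lambda>x. f (x - y) * (g x - g (x - y)))" for y
        using less.hyps[OF _ f_shift g] Suc by simp
      moreover have "a + b' = a' + b" using \<open>a = Suc a'\<close> Suc by simp
      ultimately have "diff_degree_le (a' + b)
          (\<lambda>x. (f x - f (x - y)) * g x + f (x - y) * (g x - g (x - y)))" for y
        by (intro diff_degree_le_add) simp_all
      then have "diff_degree_le (Suc (a' + b)) (\<lambda>x. f x * g x)"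
        by (simp add: left_diff_distrib right_diff_distrib)
      then show ?thesis using \<open>a = Suc a'\<close> by simp
    qed
  qed
qed

lemma diff_degree_le_power: "diff_degree_le a f \<Longrightarrow> diff_degree_le (n * a) (\<lambda>x. f x ^ n)"
proof (induction n)
  case 0
  then show ?case by (simp add: diff_degree_le_const del: diff_degree_le.simps)
next
  case (Suc n)
  then have "diff_degree_le (a + n * a) (\<lambda>x. f x * f x ^ n)" by (intro diff_degree_le_mult)
  then show ?case by simp
qed

text \<open>By Fermat's little theorem, the indicator function of the origin is the polynomial
  \<open>(1 - q\<^sub>1^4) (1 - q\<^sub>2^4)\<close>.\<close>

lemma diff_degree_le_delta: "diff_degree_le 8 (\<lambda>q::F5 ^ 2. if q = 0 then 1 else 0 :: F5)"
proof -
  have coord: "diff_degree_le 4 (\<lambda>q::F5 ^ 2. 1 - (q $ i) ^ 4)" for i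
  proof -
    have "diff_degree_le 1 (\<lambda>q::F5 ^ 2. q $ i)" by simp
    from diff_degree_le_power[OF this, of 4] have "diff_degree_le 4 (\<lambda>q::F5 ^ 2. (q $ i) ^ 4)"
      by (simp only: mult_1_right)
    then show ?thesis by (intro diff_degree_le_diff diff_degree_le_const)
  qed
  have "(if q = 0 then 1 else 0 :: F5) = (1 - (q $ 1) ^ 4) * (1 - (q $ 2) ^ 4)" for q :: "F5 ^ 2"
    by (cases "q $ 1 = 0"; cases "q $ 2 = 0") (auto simp: vec_eq_iff forall_2 F5_power4)
  then have eq: "(\<lambda>q::F5 ^ 2. if q = 0 then 1 else 0 :: F5) =
      (\<lambda>q. (1 - (q $ 1) ^ 4) * (1 - (q $ 2) ^ 4))" by (rule ext)
  have "diff_degree_le (4 + 4) (\<lambda>q::F5 ^ 2. (1 - (q $ 1) ^ 4) * (1 - (q $ 2) ^ 4) :: F5)"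
    by (rule diff_degree_le_mult[OF coord coord])
  then show ?thesis unfolding eq by (simp only: numeral_Bit0[symmetric])
qed


section \<open>Counting sub-multisets with a given sum\<close>

text \<open>The number of sub-multisets (counted as subsets of positions) with sum \<open>g\<close>, signed by the parity of
  their size. Those that contain \<open>x\<close> are counted by the subtracted term.\<close>

primrec signed_count :: "(F5 ^ 2) list \<Rightarrow> F5 ^ 2 \<Rightarrow> F5" where
  "signed_count [] g = (if g = 0 then 1 else 0)"
| "signed_count (x # xs) g = signed_count xs g - signed_count xs (g - x)"

lemma signed_count_degree:
  "length xs \<le> 8 \<Longrightarrow> diff_degree_le (8 - length xs) (signed_count xs)"
proof (induction xs)
  case Nil
  have "signed_count [] = (\<lambda>q. if q = 0 then 1 else 0)" by (rule ext) simp
  then show ?case using diff_degree_le_delta by (simp only: list.size diff_zero)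
next
  case (Cons x xs)
  have "8 - length xs = Suc (8 - length (x # xs))" using Cons.prems by simp
  then have "diff_degree_le (Suc (8 - length (x # xs))) (signed_count xs)"
    using Cons by (simp del: diff_degree_le.simps)
  then have "diff_degree_le (8 - length (x # xs)) (\<lambda>g. signed_count xs g - signed_count xs (g - x))"
    by (simp only: diff_degree_le.simps)
  moreover have "signed_count (x # xs) = (\<lambda>g. signed_count xs g - signed_count xs (g - x))"
    by (rule ext) simp
  ultimately show ?case by (simp only:)
qed

lemma signed_count_const: "length xs = 8 \<Longrightarrow> signed_count xs g = signed_count xs h"
  using signed_count_degree[of xs] by auto

lemma signed_count_eq_0:
  assumes "\<And>T. T \<subseteq># mset xs \<Longrightarrow> sum_mset T \<noteq> g"
  shows "signed_count xs g = 0"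
  using assms
proof (induction xs arbitrary: g)
  case Nil
  then show ?case using Nil[of "{#}"] by auto
next
  case (Cons x xs)
  have "sum_mset T \<noteq> g" if "T \<subseteq># mset xs" for T
    using that Cons.prems[of T] by (simp add: subset_mset.order_trans[of _ "mset xs"])
  moreover have "sum_mset T \<noteq> g - x" if "T \<subseteq># mset xs" for T
    using that Cons.prems[of "add_mset x T"] by (auto simp: algebra_simps)
  ultimately show ?case using Cons.IH by simp
qed

definition zero_sum_free :: "(F5 ^ 2) multiset \<Rightarrow> bool" where
  "zero_sum_free R \<longleftrightarrow> (\<forall>T. T \<subseteq># R \<longrightarrow> zero_sum T \<longrightarrow> T = {#})"

lemma signed_count_zero_sum_free:
  assumes "zero_sum_free (mset xs)"
  shows "signed_count xs 0 = 1"
  using assms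
proof (induction xs)
  case (Cons x xs)
  have "zero_sum_free (mset xs)"
    using Cons.prems unfolding zero_sum_free_def
    by (auto simp: subset_mset.order_trans[of _ "mset xs"])
  moreover have "sum_mset T \<noteq> 0 - x" if "T \<subseteq># mset xs" for T
    using that Cons.prems[unfolded zero_sum_free_def, rule_format, of "add_mset x T"]
    by (auto simp: zero_sum_def)
  ultimately show ?case using Cons.IH signed_count_eq_0[of xs "0 - x"] by simp
qed simp

text \<open>The Davenport constant of the plane is at most 9. Eight elements give a
  constant signed count, and one more difference turns it into zero; but if only the empty
  multiset has sum zero, the signed count at the origin is 1.\<close>

lemma zero_sum_free_size:
  assumes "zero_sum_free R"
  shows "size R \<le> 8"
proof (rule ccontr)
  assume "\<not> size R \<le> 8"
  then have "8 < size R" by simp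
  obtain zs where zs: "mset zs = R" using ex_mset by blast
  then have len: "8 < length zs" using \<open>8 < size R\<close> by auto
  define ys where "ys = take 9 zs"
  have "length ys = 9" using len by (simp add: ys_def)
  then obtain x xs where ys: "ys = x # xs" "length xs = 8" by (cases ys) auto
  have "mset ys \<subseteq># R" unfolding ys_def zs[symmetric]
    by (metis append_take_drop_id mset_append mset_subset_eq_add_left)
  then have "zero_sum_free (mset ys)"
    using assms unfolding zero_sum_free_def by (meson subset_mset.order_trans)
  then have "signed_count ys 0 = 1" by (rule signed_count_zero_sum_free)
  moreover have "signed_count ys 0 = 0"
    using signed_count_const[OF ys(2)] unfolding ys(1) by simp
  ultimately show False by simp
qed

lemma signed_count_singletons:
  assumes "\<And>T. T \<subseteq># mset xs \<Longrightarrow> sum_mset T = b \<Longrightarrow> T = {#b#}"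
    and "zero_sum_free (mset xs)" and "b \<noteq> 0"
  shows "signed_count xs b = - of_nat (count (mset xs) b)"
  using assms
proof (induction xs)
  case (Cons x xs)
  have sub: "T \<subseteq># mset xs \<Longrightarrow> T \<subseteq># mset (x # xs)" for T
    by (simp add: subset_mset.order_trans[of _ "mset xs"])
  have free: "zero_sum_free (mset xs)"
    using Cons.prems(2) sub unfolding zero_sum_free_def by blast
  have IH: "signed_count xs b = - of_nat (count (mset xs) b)"
    using Cons.IH Cons.prems(1)[OF sub] free Cons.prems(3) by blast
  show ?case
  proof (cases "x = b")
    case True
    then show ?thesis using IH signed_count_zero_sum_free[OF free] by simp
  next
    case False
    have "sum_mset T \<noteq> b - x" if "T \<subseteq># mset xs" for T
    proof
      assume "sum_mset T = b - x"
      then have "add_mset x T = {#b#}" using that by (intro Cons.prems(1)) auto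
      then show False using False by simp
    qed
    then show ?thesis using IH False signed_count_eq_0[of xs "b - x"] by simp
  qed
qed simp

text \<open>The signed count is constant on the plane. It is 1 at the origin and minus the
  multiplicity of \<open>b\<close> at \<open>b\<close>, so this multiplicity is \<open>-1\<close> modulo 5.\<close>

lemma zero_sum_free_count_ge_4:
  assumes "zero_sum_free R" and "size R = 8" and "b \<noteq> 0"
    and "\<And>T. T \<subseteq># R \<Longrightarrow> sum_mset T = b \<Longrightarrow> T = {#b#}"
  shows "count R b \<ge> 4"
proof -
  obtain xs where xs: "mset xs = R" using ex_mset by blast
  then have "length xs = 8" using assms(2) by auto
  then have "signed_count xs b = signed_count xs 0" by (rule signed_count_const)
  also have "\<dots> = 1" using signed_count_zero_sum_free xs assms(1) by simp
  finally have "- of_nat (count R b) = (1::F5)"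
    using signed_count_singletons[of xs b] xs assms by simp
  then have "of_nat (count R b) = (- 1::F5)" by (metis minus_minus)
  then have "(of_nat (Suc (count R b)) :: F5) = 0" by simp
  then have "5 dvd Suc (count R b)" by (simp only: of_nat_F5_eq_0_iff)
  then show ?thesis by (auto dest: dvd_imp_le)
qed


section \<open>Large non-collinear zero-sum blocks\<close>

lemma zero_sum_union: "zero_sum S \<Longrightarrow> zero_sum T \<Longrightarrow> zero_sum (S + T)"
  by (simp add: zero_sum_def)

lemma collinear_mset_subset: "S \<subseteq># T \<Longrightarrow> collinear_mset T \<Longrightarrow> collinear_mset S"
  unfolding collinear_mset_def by (meson mset_subset_eqD)

text \<open>Suppose that all zero-sum sub-multisets are collinear. Two nonempty ones on different lines would be
  disjoint with a union that spans the plane, so all lie on one line; let \<open>A\<close> be the part of \<open>Q\<close> on this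
  line and \<open>C\<close> the rest. If \<open>A\<close> has four or more elements, its subset sums fill the line; as \<open>C\<close> has
  five elements, some nonempty part of it has its sum on the line, and a part of \<open>A\<close>
  completes it to a zero-sum. If \<open>A\<close> has at most three elements, one of them can be deleted
  so that the others are zero-sum-free; then nine or more elements of \<open>Q\<close> are left, and none of their
  nonempty sub-multisets has sum zero, which is impossible.\<close>

lemma ex_noncollinear_zero_sum:
  assumes nz: "0 \<notin># Q" and size: "size Q \<ge> 10"
    and off: "\<And>a. a \<noteq> 0 \<Longrightarrow> size {# q \<in># Q. det2 a q \<noteq> 0 #} \<ge> 5"
  shows "\<exists>B. B \<subseteq># Q \<and> zero_sum B \<and> \<not> collinear_mset B"
proof (rule ccontr)
  assume "\<not> ?thesis"
  then have col: "collinear_mset B" if "B \<subseteq># Q" "zero_sum B" for B using that by blast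
  have "\<not> zero_sum_free Q" using zero_sum_free_size[of Q] size by auto
  then obtain T where T: "T \<subseteq># Q" "zero_sum T" "T \<noteq> {#}" unfolding zero_sum_free_def by blast
  then obtain a where aT: "a \<in># T" by blast
  then have a0: "a \<noteq> 0" using T nz by (metis mset_subset_eqD)
  have T_on: "det2 a q = 0" if "q \<in># T" for q
    using col[OF T(1,2)] aT that unfolding collinear_mset_def by blast
  define A where "A = {# q \<in># Q. det2 a q = 0 #}"
  define C where "C = {# q \<in># Q. det2 a q \<noteq> 0 #}"
  have Q: "Q = A + C" unfolding A_def C_def by (rule multiset_partition)
  have aA: "a \<in># A" using aT T(1) by (auto simp: A_def dest: mset_subset_eqD)
  have on: "T' \<subseteq># A" if T': "T' \<subseteq># Q" "zero_sum T'" for T'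
  proof -
    have "det2 a q = 0" if "q \<in># T'" for q
    proof (rule ccontr)
      assume q: "det2 a q \<noteq> 0"
      have "r \<notin># T'" if "r \<in># T" for r
      proof
        assume "r \<in># T'"
        then have "det2 r q = 0"
          using col[OF T'] \<open>q \<in># T'\<close> unfolding collinear_mset_def by blast
        moreover have "det2 r a = 0" using T_on[OF that] by (simp add: det2_eq_0_swap)
        moreover have "r \<noteq> 0" using that T(1) nz by (metis mset_subset_eqD)
        ultimately show False using q by (blast intro: det2_eq_0_trans)
      qed
      then have "T \<inter># T' = {#}" by (auto simp: disjunct_not_in)
      then have "T + T' = T \<union># T'" by (simp add: union_diff_inter_eq_sup[symmetric])
      then have "T + T' \<subseteq># Q" using T(1) T'(1) by simp
      then have "collinear_mset (T + T')" using col zero_sum_union T(2) T'(2) by blast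
      then show False using q aT \<open>q \<in># T'\<close> unfolding collinear_mset_def by simp
    qed
    then have "{# q \<in># T'. det2 a q = 0 #} = {# q \<in># T'. True #}"
      by (intro filter_mset_cong) auto
    then have "{# q \<in># T'. det2 a q = 0 #} = T'" by simp
    then show ?thesis unfolding A_def by (metis T'(1) multiset_filter_mono)
  qed
  have off_line: False if "T' \<subseteq># Q" "zero_sum T'" "c \<in># T'" "c \<in># C" for T' c
    using on[OF that(1,2)] that(3,4) unfolding A_def C_def by (auto dest: mset_subset_eqD)
  show False
  proof (cases "size A \<ge> 4")
    case True
    have "size C \<ge> 5" unfolding C_def by (rule off[OF a0])
    \<comment> \<open>One element \<open>c\<close> is set aside so that the part of \<open>C\<close> chosen below is nonempty.\<close>
    then obtain c C0 where C: "C = add_mset c C0" by (cases C) auto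
    then have "size C0 \<ge> 4" using \<open>size C \<ge> 5\<close> by simp
    moreover have "det2 a q \<noteq> 0" if "q \<in># C0" for q
    proof -
      have "q \<in># C" using that C by simp
      then show ?thesis by (simp add: C_def)
    qed
    ultimately obtain S where S: "S \<subseteq># C0" "(\<Sum>q\<in>#S. det2 a q) = - det2 a c"
      using subset_sums_cover_F5[of C0 "det2 a"] by blast
    then have "det2 a (sum_mset (add_mset c S)) = 0"
      by (simp add: det2_add_right det2_sum_mset_right)
    then obtain t where t: "sum_mset (add_mset c S) = t *s a"
      using det2_eq_0_imp_scaled[OF a0] by blast
    define f where "f q = (SOME t. q = t *s a)" for q
    have f: "q = f q *s a" if "q \<in># A" for q
      using that det2_eq_0_imp_scaled[OF a0] unfolding f_def A_def by (auto intro: someI_ex)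
    have "f q \<noteq> 0" if "q \<in># A" for q
      using f[OF that] that nz unfolding A_def by auto
    then obtain U where U: "U \<subseteq># A" "(\<Sum>q\<in>#U. f q) = - t"
      using subset_sums_cover_F5[of A f] True by blast
    have "sum_mset U = (\<Sum>q\<in>#U. f q) *s a"
      using U(1)
    proof (induction U)
      case (add q U)
      have "q \<in># A" "U \<subseteq># A" using add.prems
        by (auto dest: mset_subset_eqD mset_subset_eq_insertD subset_mset.less_imp_le)
      then show ?case using add.IH f[of q] by (simp add: vec.scale_left_distrib)
    qed simp
    then have "sum_mset U + sum_mset (add_mset c S) = 0"
      unfolding t U(2) by (simp add: vec.scale_minus_left)
    then have "zero_sum (U + add_mset c S)" unfolding zero_sum_def by (simp only: sum_mset.union)
    moreover have "U + add_mset c S \<subseteq># Q"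
      unfolding Q C using U(1) S(1) by (intro subset_mset.add_mono) auto
    ultimately show False using off_line[of "U + add_mset c S" c] C by simp
  next
    case False
    \<comment> \<open>At least nine elements of \<open>Q\<close> remain without \<open>e\<close>, so the rest of \<open>A\<close> has a zero-sum part. It can only
      be an opposite pair, which is all the rest of \<open>A\<close>.\<close>
    have *: "size A = 3 \<and> sum_mset A = e" if "e \<in># A" for e
    proof -
      obtain A' where A': "A = add_mset e A'" using multi_member_split[OF \<open>e \<in># A\<close>] by blast
      have "size Q = size (A' + C) + 1" unfolding Q A' by simp
      then have "\<not> zero_sum_free (A' + C)" using zero_sum_free_size[of "A' + C"] size by linarith
      then obtain T' where T': "T' \<subseteq># A' + C" "zero_sum T'" "T' \<noteq> {#}"
        unfolding zero_sum_free_def by blast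
      have "A' + C \<subseteq># Q" unfolding Q A' by simp
      then have T'A: "T' \<subseteq># A" using T' on by (meson subset_mset.order_trans)
      have "T' \<subseteq># A'"
      proof (rule mset_subset_eqI)
        fix q
        show "count T' q \<le> count A' q"
        proof (cases "q \<in># C")
          case True
          then have "q \<notin># A" by (simp add: A_def C_def)
          then show ?thesis using T'A by (metis count_eq_zero_iff le0 mset_subset_eqD)
        next
          case False
          then show ?thesis
            using mset_subset_eq_count[OF T'(1), of q] by (simp add: not_in_iff)
        qed
      qed
      moreover have "size T' \<ge> 2"
      proof (rule ccontr)
        assume "\<not> size T' \<ge> 2"
        moreover have "0 < size T'" using T'(3) by (simp only: nonempty_has_size)
        ultimately have "size T' = 1" by linarith
        then obtain q where "T' = {#q#}" using size_1_singleton_mset by blast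
        then show False using T'(2) T'A nz Q unfolding zero_sum_def by auto
      qed
      moreover have "size A' \<le> 2" using False A' by simp
      ultimately have "T' = A'" and "size A' = 2"
        by (metis mset_subset_size not_le order_trans subset_mset.order_iff_strict,
            meson le_antisym order_trans size_mset_mono)
      then show ?thesis using T'(2) A' unfolding zero_sum_def by simp
    qed
    define s where "s = sum_mset A"
    have "A = replicate_mset 3 s"
      using * aA unfolding s_def by (metis set_mset_subset_singletonD subsetI singletonI)
    then have "sum_mset A = s + s + s" by (simp add: numeral_3_eq_3 add.assoc)
    then have "s + s = 0" by (simp add: s_def[symmetric] add.assoc)
    then have "2 *s s = 0" by (simp add: vec_eq_iff)
    moreover have "(2::F5) \<noteq> 0" using of_nat_F5_eq_0_iff[of 2] by simp
    ultimately have "s = 0" by simp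
    then show False using *[OF aA] a0 by (simp add: s_def)
  qed
qed

text \<open>A largest such block is long enough: otherwise its complement is zero-sum-free of the maximal
  size 8, no element of the block can be exchanged for several elements of the complement, and
  the multiplicities this forces put the whole block into the complement.\<close>

lemma ex_large_noncollinear_zero_sum:
  assumes nz: "0 \<notin># Q" and k: "1 \<le> k" "k \<le> 4" and size: "size Q = 9 + k"
    and off: "\<And>a. a \<noteq> 0 \<Longrightarrow> size {# q \<in># Q. det2 a q \<noteq> 0 #} \<ge> 5"
  shows "\<exists>B. B \<subseteq># Q \<and> zero_sum B \<and> \<not> collinear_mset B \<and> size B \<ge> k + 2"
proof -
  define block where "block B \<longleftrightarrow> B \<subseteq># Q \<and> zero_sum B \<and> \<not> collinear_mset B" for B
  obtain B0 where "block B0"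
    using ex_noncollinear_zero_sum[OF nz _ off] size k unfolding block_def by auto
  moreover have "\<forall>B. block B \<longrightarrow> size B < Suc (size Q)"
    unfolding block_def by (auto simp: less_Suc_eq_le intro: size_mset_mono)
  ultimately obtain B where B: "block B" "\<And>B'. block B' \<Longrightarrow> size B' \<le> size B"
    using ex_has_greatest_nat[of block B0 size "Suc (size Q)"] by blast
  define R where "R = Q - B"
  have Q: "Q = B + R" using B(1) by (simp add: R_def block_def)
  have "size B \<ge> k + 2"
  proof (rule ccontr)
    assume small: "\<not> size B \<ge> k + 2"
    have free: "zero_sum_free R"
      unfolding zero_sum_free_def
    proof (intro allI impI)
      fix T assume T: "T \<subseteq># R" "zero_sum T"
      then have "block (B + T)"
        using B(1) Q zero_sum_union collinear_mset_subset[of B "B + T"] unfolding block_def by auto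
      then show "T = {#}" using B(2)[of "B + T"] by simp
    qed
    then have R8: "size R = 8" using zero_sum_free_size[OF free] size Q small by simp
    have count_R: "count R b \<ge> 4" if b: "b \<in># B" for b
    proof (rule zero_sum_free_count_ge_4[OF free R8])
      show b0: "b \<noteq> 0" using b Q nz by auto
      obtain B' where B': "B = add_mset b B'" using b by (metis mset_add)
      fix T assume T: "T \<subseteq># R" "sum_mset T = b"
      have "block (B' + T)"
        unfolding block_def
      proof (intro conjI notI)
        show "B' + T \<subseteq># Q" unfolding Q B' using T(1)
          by (intro subset_mset.add_mono) auto
        show "zero_sum (B' + T)" using B(1) T(2) unfolding block_def zero_sum_def B'
          by (simp add: add.commute)
        \<comment> \<open>The exchanged element \<open>b\<close> is a sum over \<open>T\<close>, hence would lie on the same line.\<close>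
        assume c: "collinear_mset (B' + T)"
        have "det2 q b = 0" if "q \<in># B'" for q
          unfolding T(2)[symmetric] using c that unfolding collinear_mset_def
          by (intro det2_sum_mset_eq_0) auto
        then have "collinear_mset B"
          using c unfolding B' collinear_mset_def by (auto simp: det2_eq_0_swap[of b])
        then show False using B(1) by (simp add: block_def)
      qed
      then have "size T \<le> 1" using B(2) B' by fastforce
      moreover have "T \<noteq> {#}" using T(2) b0 by auto
      then have "0 < size T" by (simp only: nonempty_has_size)
      ultimately have "size T = 1" by linarith
      then obtain q where "T = {#q#}" using size_1_singleton_mset by blast
      then show "T = {#b#}" using T(2) by simp
    qed
    have "B \<subseteq># R"
    proof (rule mset_subset_eqI)
      fix b
      show "count B b \<le> count R b"
      proof (cases "b \<in># B")
        case True
        have "\<exists>q\<in>#B. q \<noteq> b"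
          using B(1) unfolding block_def collinear_mset_def by (metis det2_self)
        then obtain q where q: "q \<in># B" "q \<noteq> b" by blast
        then obtain B' where "B = add_mset q B'" by (metis mset_add)
        then have "count B b \<le> size B'" using q(2) by (simp add: count_le_size)
        also have "\<dots> \<le> 4" using \<open>B = add_mset q B'\<close> small k by simp
        also have "\<dots> \<le> count R b" using count_R[OF True] .
        finally show ?thesis .
      qed (simp add: not_in_iff)
    qed
    then have "B = {#}" using free B(1) unfolding zero_sum_free_def block_def by blast
    then show False using B(1) by (simp add: block_def collinear_mset_def)
  qed
  then show ?thesis using B(1) unfolding block_def by blast
qed


section \<open>The spread\<close>

lemma spread_ge_single_block:
  assumes "B \<subseteq># Q" and "B \<noteq> {#}" and "zero_sum B"
  shows "card (cross_sum_set B) - 1 \<le> spread Q"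
proof -
  have "{#B#} \<in> zero_sum_families Q" using assms by (simp add: zero_sum_families_def)
  then show ?thesis unfolding spread_def
    by (intro Max_ge finite_imageI finite_zero_sum_families image_eqI[of _ _ "{#B#}"]) simp_all
qed

theorem proposition2:
  fixes z :: nat and Q :: "(F5 ^ 2) multiset"
  assumes "z \<in> {0, 1, 2, 3}"
    and "size Q = 13 - z"
    and "0 \<notin># Q"
    and "\<And>L. line L \<Longrightarrow> line_mult L Q \<le> 8 - z"
  shows "spread Q \<ge> 4 - z"
proof -
  define k where "k = 4 - z"
  have k: "1 \<le> k" "k \<le> 4" "size Q = 9 + k" "8 - z = 4 + k"
    using assms(1,2) by (auto simp: k_def)
  have "size {# q \<in># Q. det2 a q \<noteq> 0 #} \<ge> 5" if "a \<noteq> 0" for a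
  proof -
    have "size {# q \<in># Q. det2 a q = 0 #} \<le> 4 + k"
      using assms(4)[OF line_det2[OF that]] k(4) by (simp add: line_mult_def)
    moreover have "size Q = size {# q \<in># Q. det2 a q = 0 #} + size {# q \<in># Q. det2 a q \<noteq> 0 #}"
      by (metis multiset_partition size_union)
    ultimately show ?thesis using k(3) by simp
  qed
  then obtain B where B: "B \<subseteq># Q" "zero_sum B" "\<not> collinear_mset B" "size B \<ge> k + 2"
    using ex_large_noncollinear_zero_sum[OF assms(3) k(1-3)] by blast
  have "0 \<notin># B" using B(1) assms(3) by (metis mset_subset_eqD)
  then have "k + 1 \<le> card (cross_sum_set B)"
    using card_cross_sum_set_zero_sum[OF B(2) _ B(3)] B(4) k(2) by simp
  moreover have "B \<noteq> {#}" using B(4) by auto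
  ultimately have "k \<le> spread Q" using spread_ge_single_block[OF B(1) _ B(2)] by simp
  then show ?thesis by (simp add: k_def)
qed

end
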